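(* Let $P:\mathbb C^{\mathrm{op}}\to\mathbf{Pos}$ be a primary doctrine, $X$ an object of $\mathbb C$ and $\varphi\in P(X)$, and let $P_{(X,\varphi)}$ be the associated Kleisli doctrine with canonical 1-arrow $(F_X,\mathfrak f):P\to P_{(X,\varphi)}$. Then $P_{(X,\varphi)}$ is a primary doctrine, and $(F_X,\mathfrak f)$ is a primary homomorphism.
   Context: A doctrine is a functor $P:\mathbb C^{\mathrm{op}}\to\mathbf{Pos}$ with $\mathbb C$ a category with finite products and $\mathbf{Pos}$ the category of posets and monotone maps; the maps $P(f)$ are called reindexings. It is primary if every $P(A)$ has finite meets ($\wedge$, $\top$) and all reindexings preserve them. A 1-arrow (doctrine homomorphism) from $P:\mathbb C^{\mathrm{op}}\to\mathbf{Pos}$ to $R:\mathbb D^{\mathrm{op}}\to\mathbf{Pos}$ is a pair $(F,\mathfrak f)$ with $F:\mathbb C\to\mathbb D$ a finite-product-preserving functor and $\mathfrak f:P\to R\circ F^{\mathrm{op}}$ natural; it is primary if $P,R$ are primary and each $\mathfrak f_A$ preserves finite meets. Kleisli doctrine (the Kleisli object of the comonad on $P$ given by $X\times-$ and $\alpha\mapsto P(\mathrm{pr}_1)(\varphi)\wedge P(\mathrm{pr}_2)(\alpha)$). The category $\mathbb C_X$ has the same objects as $\mathbb C$; an arrow $g:A\rightsquigarrow B$ in $\mathbb C_X$ is a $\mathbb C$-arrow $g:X\times A\to B$; the identity of $A$ is $\mathrm{pr}_2:X\times A\to A$; the composite of $g:A\rightsquigarrow B$ and $h:B\rightsquigarrow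 C$ is $h\langle\mathrm{pr}_1,g\rangle$. It has finite products, given on objects by those of $\mathbb C$. The doctrine $P_{(X,\varphi)}:\mathbb C_X^{\mathrm{op}}\to\mathbf{Pos}$ has $P_{(X,\varphi)}(A)=\{\alpha\in P(X\times A)\mid\alpha\le P(\mathrm{pr}_1)(\varphi)\}$ with the order of $P(X\times A)$, and reindexing along $g:A\rightsquigarrow B$ is the restriction of $P(\langle\mathrm{pr}_1,g\rangle)$. The 1-arrow $(F_X,\mathfrak f):P\to P_{(X,\varphi)}$: $F_X:\mathbb C\to\mathbb C_X$ is the identity on objects and sends $f:A\to B$ to $f\,\mathrm{pr}_2:A\rightsquigarrow B$; $\mathfrak f_A(\alpha)=P(\mathrm{pr}_1)(\varphi)\wedge P(\mathrm{pr}_2)(\alpha)$, for $\mathrm{pr}_1,\mathrm{pr}_2$ the projections from $X\times A$. *)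

theory Defs
  imports "HOL-Algebra.Lattice"
begin

section \<open>Categories with finite products\<close>

text \<open>
  Hom-sets are families indexed by domain and codomain and are not required to be
  disjoint: the same \<^typ>\<open>'m\<close> may be an arrow between several pairs of objects.  This
  is needed for the category \<open>C\<^sub>X\<close> below, where an arrow from \<open>A\<close> to \<open>B\<close> is an
  arrow \<open>X \<times> A \<rightarrow> B\<close> of \<open>C\<close> and does not determine \<open>A\<close>.  Hence composition and all
  actions on arrows take the objects involved as arguments:
  \<open>Comp C A B D g f\<close> is the composite of \<open>f : A \<rightarrow> B\<close> with \<open>g : B \<rightarrow> D\<close>.
\<close>

record ('o, 'm) category =
  Ob :: "'o set"
  Hom :: "'o \<Rightarrow> 'o \<Rightarrow> 'm set"
  Id :: "'o \<Rightarrow> 'm"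
  Comp :: "'o \<Rightarrow> 'o \<Rightarrow> 'o \<Rightarrow> 'm \<Rightarrow> 'm \<Rightarrow> 'm"

locale category =
  fixes C :: "('o, 'm, 'x) category_scheme"
  assumes Id_closed: "A \<in> Ob C \<Longrightarrow> Id C A \<in> Hom C A A"
    and Comp_closed:
      "\<lbrakk>A \<in> Ob C; B \<in> Ob C; D \<in> Ob C; f \<in> Hom C A B; g \<in> Hom C B D\<rbrakk>
        \<Longrightarrow> Comp C A B D g f \<in> Hom C A D"
    and Comp_Id_left:
      "\<lbrakk>A \<in> Ob C; B \<in> Ob C; f \<in> Hom C A B\<rbrakk> \<Longrightarrow> Comp C A B B (Id C B) f = f"
    and Comp_Id_right:
      "\<lbrakk>A \<in> Ob C; B \<in> Ob C; f \<in> Hom C A B\<rbrakk> \<Longrightarrow> Comp C A A B f (Id C A) = f"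
    and Comp_assoc:
      "\<lbrakk>A \<in> Ob C; B \<in> Ob C; D \<in> Ob C; E \<in> Ob C;
        f \<in> Hom C A B; g \<in> Hom C B D; h \<in> Hom C D E\<rbrakk>
        \<Longrightarrow> Comp C A D E h (Comp C A B D g f) = Comp C A B E (Comp C B D E h g) f"

definition is_terminal :: "('o, 'm, 'x) category_scheme \<Rightarrow> 'o \<Rightarrow> bool"
  where "is_terminal C T \<longleftrightarrow> T \<in> Ob C \<and> (\<forall>Z\<in>Ob C. \<exists>!h. h \<in> Hom C Z T)"

definition is_product ::
    "('o, 'm, 'x) category_scheme \<Rightarrow> 'o \<Rightarrow> 'o \<Rightarrow> 'o \<Rightarrow> 'm \<Rightarrow> 'm \<Rightarrow> bool"
  where "is_product C A B Q p q \<longleftrightarrow>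
    Q \<in> Ob C \<and> p \<in> Hom C Q A \<and> q \<in> Hom C Q B \<and>
    (\<forall>Z\<in>Ob C. \<forall>f\<in>Hom C Z A. \<forall>g\<in>Hom C Z B.
      \<exists>!h. h \<in> Hom C Z Q \<and> Comp C Z Q A p h = f \<and> Comp C Z Q B q h = g)"

text \<open>Finite products are given by a choice of a terminal object and of binary products.\<close>

record ('o, 'm) fp_category = "('o, 'm) category" +
  One :: "'o"
  Prod :: "'o \<Rightarrow> 'o \<Rightarrow> 'o"
  Pr1 :: "'o \<Rightarrow> 'o \<Rightarrow> 'm"
  Pr2 :: "'o \<Rightarrow> 'o \<Rightarrow> 'm"

locale fp_category = category C for C :: "('o, 'm, 'x) fp_category_scheme" +
  assumes One_terminal: "is_terminal C (One C)"
    and Prod_product: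
      "\<lbrakk>A \<in> Ob C; B \<in> Ob C\<rbrakk> \<Longrightarrow> is_product C A B (Prod C A B) (Pr1 C A B) (Pr2 C A B)"

text \<open>The pairing \<open>\<langle>f, g\<rangle> : Z \<rightarrow> A \<times> B\<close> of \<open>f : Z \<rightarrow> A\<close> and \<open>g : Z \<rightarrow> B\<close>.\<close>

definition pairing ::
    "('o, 'm, 'x) fp_category_scheme \<Rightarrow> 'o \<Rightarrow> 'o \<Rightarrow> 'o \<Rightarrow> 'm \<Rightarrow> 'm \<Rightarrow> 'm"
  where "pairing C Z A B f g = (THE h. h \<in> Hom C Z (Prod C A B) \<and>
    Comp C Z (Prod C A B) A (Pr1 C A B) h = f \<and>
    Comp C Z (Prod C A B) B (Pr2 C A B) h = g)"

record ('o, 'm, 'p, 'n) cat_functor =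
  ob_map :: "'o \<Rightarrow> 'p"
  hom_map :: "'o \<Rightarrow> 'o \<Rightarrow> 'm \<Rightarrow> 'n"

locale cat_functor = source: category C + target: category D
  for C :: "('o, 'm, 'x) category_scheme" and D :: "('p, 'n, 'y) category_scheme" +
  fixes F :: "('o, 'm, 'p, 'n) cat_functor"
  assumes ob_map_closed: "A \<in> Ob C \<Longrightarrow> ob_map F A \<in> Ob D"
    and hom_map_closed:
      "\<lbrakk>A \<in> Ob C; B \<in> Ob C; f \<in> Hom C A B\<rbrakk>
        \<Longrightarrow> hom_map F A B f \<in> Hom D (ob_map F A) (ob_map F B)"
    and hom_map_Id: "A \<in> Ob C \<Longrightarrow> hom_map F A A (Id C A) = Id D (ob_map F A)"
    and hom_map_Comp:
      "\<lbrakk>A \<in> Ob C; B \<in> Ob C; E \<in> Ob C; f \<in> Hom C A B; g \<in> Hom C B E\<rbrakk>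
        \<Longrightarrow> hom_map F A E (Comp C A B E g f) =
          Comp D (ob_map F A) (ob_map F B) (ob_map F E) (hom_map F B E g) (hom_map F A B f)"

text \<open>
  Preservation is meant in the usual sense, that terminal objects and product diagrams
  are sent to such; the chosen products need not be preserved on the nose.
\<close>

locale fp_functor = cat_functor C D F + source: fp_category C + target: fp_category D
  for C :: "('o, 'm, 'x) fp_category_scheme" and D :: "('p, 'n, 'y) fp_category_scheme"
    and F :: "('o, 'm, 'p, 'n) cat_functor" +
  assumes preserves_terminal: "is_terminal C T \<Longrightarrow> is_terminal D (ob_map F T)"
    and preserves_products:
      "\<lbrakk>A \<in> Ob C; B \<in> Ob C; is_product C A B Q p q\<rbrakk>
        \<Longrightarrow> is_product D (ob_map F A) (ob_map F B) (ob_map F Q)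
              (hom_map F Q A p) (hom_map F Q B q)"


section \<open>Finite meets\<close>

locale finite_meets = lower_semilattice L + weak_partial_order_top L for L (structure)

definition preserves_finite_meets ::
    "('a, 'x) gorder_scheme \<Rightarrow> ('b, 'y) gorder_scheme \<Rightarrow> ('a \<Rightarrow> 'b) \<Rightarrow> bool"
  where "preserves_finite_meets L M f \<longleftrightarrow>
    f \<top>\<^bsub>L\<^esub> = \<top>\<^bsub>M\<^esub> \<and>
    (\<forall>x\<in>carrier L. \<forall>y\<in>carrier L. f (x \<sqinter>\<^bsub>L\<^esub> y) = f x \<sqinter>\<^bsub>M\<^esub> f y)"

text \<open>
  A morphism of \<open>Pos\<close>.  The condition \<^const>\<open>isotone\<close> does not say that \<open>f\<close> maps
  carrier to carrier.
\<close>

definition monotone_map ::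
    "('a, 'x) gorder_scheme \<Rightarrow> ('b, 'y) gorder_scheme \<Rightarrow> ('a \<Rightarrow> 'b) \<Rightarrow> bool"
  where "monotone_map L M f \<longleftrightarrow>
    partial_order L \<and> partial_order M \<and> f \<in> carrier L \<rightarrow> carrier M \<and> isotone L M f"


section \<open>Doctrines\<close>

text \<open>
  \<open>fib P A\<close> is the poset \<open>P(A)\<close>, and \<open>reindex P A B f\<close> is \<open>P(f) : P(B) \<rightarrow> P(A)\<close> for
  \<open>f : A \<rightarrow> B\<close>.  Only the values of \<open>P(f)\<close> on the carrier of \<open>P(B)\<close> are relevant.
\<close>

record ('o, 'm, 'a) doctrine =
  base :: "('o, 'm) fp_category"
  fib :: "'o \<Rightarrow> 'a gorder"
  reindex :: "'o \<Rightarrow> 'o \<Rightarrow> 'm \<Rightarrow> 'a \<Rightarrow> 'a"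

locale doctrine = base: fp_category "base P"
  for P :: "('o, 'm, 'a) doctrine" +
  assumes fib_poset: "A \<in> Ob (base P) \<Longrightarrow> partial_order (fib P A)"
    and reindex_monotone:
      "\<lbrakk>A \<in> Ob (base P); B \<in> Ob (base P); f \<in> Hom (base P) A B\<rbrakk>
        \<Longrightarrow> monotone_map (fib P B) (fib P A) (reindex P A B f)"
    and reindex_Id:
      "\<lbrakk>A \<in> Ob (base P); \<alpha> \<in> carrier (fib P A)\<rbrakk>
        \<Longrightarrow> reindex P A A (Id (base P) A) \<alpha> = \<alpha>"
    and reindex_Comp:
      "\<lbrakk>A \<in> Ob (base P); B \<in> Ob (base P); D \<in> Ob (base P);
        f \<in> Hom (base P) A B; g \<in> Hom (base P) B D; \<alpha> \<in> carrier (fib P D)\<rbrakk>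
        \<Longrightarrow> reindex P A D (Comp (base P) A B D g f) \<alpha> =
          reindex P A B f (reindex P B D g \<alpha>)"

locale primary_doctrine = doctrine P for P :: "('o, 'm, 'a) doctrine" +
  assumes fib_meets: "A \<in> Ob (base P) \<Longrightarrow> finite_meets (fib P A)"
    and reindex_meets:
      "\<lbrakk>A \<in> Ob (base P); B \<in> Ob (base P); f \<in> Hom (base P) A B\<rbrakk>
        \<Longrightarrow> preserves_finite_meets (fib P B) (fib P A) (reindex P A B f)"

text \<open>The family \<open>t\<close> is the natural transformation from \<open>P\<close> to \<open>R \<circ> F\<^sup>o\<^sup>p\<close>.\<close>

locale doctrine_hom =
  source: doctrine P + target: doctrine R + fp_functor "base P" "base R" F
  for P :: "('o, 'm, 'a) doctrine" and R :: "('p, 'n, 'b) doctrine"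
    and F :: "('o, 'm, 'p, 'n) cat_functor" +
  fixes t :: "'o \<Rightarrow> 'a \<Rightarrow> 'b"
  assumes component_monotone:
      "A \<in> Ob (base P) \<Longrightarrow> monotone_map (fib P A) (fib R (ob_map F A)) (t A)"
    and natural:
      "\<lbrakk>A \<in> Ob (base P); B \<in> Ob (base P); f \<in> Hom (base P) A B; \<beta> \<in> carrier (fib P B)\<rbrakk>
        \<Longrightarrow> t A (reindex P A B f \<beta>) =
          reindex R (ob_map F A) (ob_map F B) (hom_map F A B f) (t B \<beta>)"

locale primary_hom =
  doctrine_hom P R F t + source: primary_doctrine P + target: primary_doctrine R
  for P :: "('o, 'm, 'a) doctrine" and R :: "('p, 'n, 'b) doctrine"
    and F :: "('o, 'm, 'p, 'n) cat_functor" and t :: "'o \<Rightarrow> 'a \<Rightarrow> 'b" +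
  assumes component_meets:
      "A \<in> Ob (base P) \<Longrightarrow> preserves_finite_meets (fib P A) (fib R (ob_map F A)) (t A)"


section \<open>The Kleisli doctrine\<close>

text \<open>
  \<open>kleisli_lift C X A B g\<close> is \<open>\<langle>pr\<^sub>1, g\<rangle> : X \<times> A \<rightarrow> X \<times> B\<close> for \<open>g : X \<times> A \<rightarrow> B\<close>.
\<close>

definition kleisli_lift ::
    "('o, 'm, 'x) fp_category_scheme \<Rightarrow> 'o \<Rightarrow> 'o \<Rightarrow> 'o \<Rightarrow> 'm \<Rightarrow> 'm"
  where "kleisli_lift C X A B g = pairing C (Prod C X A) X B (Pr1 C X A) g"

definition kleisli_functor ::
    "('o, 'm, 'x) fp_category_scheme \<Rightarrow> 'o \<Rightarrow> ('o, 'm, 'o, 'm) cat_functor"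
  where "kleisli_functor C X =
    \<lparr>ob_map = (\<lambda>A. A),
     hom_map = (\<lambda>A B f. Comp C (Prod C X A) A B f (Pr2 C X A))\<rparr>"

text \<open>
  The chosen products of \<open>C\<^sub>X\<close> are those of \<open>C\<close> on objects; the projections are the
  images of those of \<open>C\<close> under the functor \<open>C \<rightarrow> C\<^sub>X\<close>.
\<close>

definition kleisli_category ::
    "('o, 'm) fp_category \<Rightarrow> 'o \<Rightarrow> ('o, 'm) fp_category"
  where "kleisli_category C X =
    \<lparr>Ob = Ob C,
     Hom = (\<lambda>A B. Hom C (Prod C X A) B),
     Id = (\<lambda>A. Pr2 C X A),
     Comp = (\<lambda>A B D h g. Comp C (Prod C X A) (Prod C X B) D h (kleisli_lift C X A B g)),
     One = One C,
     Prod = Prod C,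
     Pr1 = (\<lambda>A B. hom_map (kleisli_functor C X) (Prod C A B) A (Pr1 C A B)),
     Pr2 = (\<lambda>A B. hom_map (kleisli_functor C X) (Prod C A B) B (Pr2 C A B))\<rparr>"

definition kleisli_doctrine ::
    "('o, 'm, 'a) doctrine \<Rightarrow> 'o \<Rightarrow> 'a \<Rightarrow> ('o, 'm, 'a) doctrine"
  where "kleisli_doctrine P X \<phi> = (let C = base P in
    \<lparr>base = kleisli_category C X,
     fib = (\<lambda>A. (fib P (Prod C X A))
       \<lparr>carrier := {\<alpha> \<in> carrier (fib P (Prod C X A)).
          \<alpha> \<sqsubseteq>\<^bsub>fib P (Prod C X A)\<^esub> reindex P (Prod C X A) X (Pr1 C X A) \<phi>}\<rparr>),
     reindex = (\<lambda>A B g. reindex P (Prod C X A) (Prod C X B) (kleisli_lift C X A B g))\<rparr>)"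

definition kleisli_component :: "('o, 'm, 'a) doctrine \<Rightarrow> 'o \<Rightarrow> 'a \<Rightarrow> 'o \<Rightarrow> 'a \<Rightarrow> 'a"
  where "kleisli_component P X \<phi> A \<alpha> = (let C = base P; XA = Prod C X A in
    reindex P XA X (Pr1 C X A) \<phi> \<sqinter>\<^bsub>fib P XA\<^esub> reindex P XA A (Pr2 C X A) \<alpha>)"

end

theory Submission
  imports Defs
begin

text \<open>
  All of the categorical structure of \<open>C\<^sub>X\<close> comes from \<open>g \<mapsto> \<langle>pr\<^sub>1, g\<rangle>\<close>, which identifies
  the arrows from \<open>A\<close> to \<open>B\<close> in \<open>C\<^sub>X\<close> with the arrows \<open>X \<times> A \<rightarrow> X \<times> B\<close> of \<open>C\<close> over \<open>X\<close> and turns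
  Kleisli composition into composition in \<open>C\<close>.  Since an arrow over \<open>X\<close> commutes with \<open>pr\<^sub>1\<close>,
  reindexing along it fixes the family \<open>P(pr\<^sub>1)(\<phi>)\<close>; hence it restricts to the principal
  down-sets of these elements, whose meets are those of the ambient semilattice and whose
  top element is \<open>P(pr\<^sub>1)(\<phi>)\<close>.
\<close>

section \<open>Finite meets and principal down-sets\<close>

context finite_meets
begin

lemma meet_eqI:
  assumes "x \<in> carrier L" "y \<in> carrier L" "m \<in> carrier L" "m \<sqsubseteq> x" "m \<sqsubseteq> y"
    and "\<And>z. \<lbrakk>z \<in> carrier L; z \<sqsubseteq> x; z \<sqsubseteq> y\<rbrakk> \<Longrightarrow> z \<sqsubseteq> m"
  shows "x \<sqinter> y = m"
proof (rule le_antisym)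
  show "x \<sqinter> y \<sqsubseteq> m"
    using assms by (simp add: meet_left meet_right)
  show "m \<sqsubseteq> x \<sqinter> y"
    using assms by (simp add: meet_le)
qed (use assms in auto)

lemma top_eqI:
  assumes "u \<in> carrier L" "\<And>z. z \<in> carrier L \<Longrightarrow> z \<sqsubseteq> u"
  shows "\<top> = u"
  using assms by (blast intro: le_antisym)

lemma meet_top:
  assumes "x \<in> carrier L"
  shows "x \<sqinter> \<top> = x"
  using assms by (intro meet_eqI) auto

lemma meet_mono:
  assumes "x \<in> carrier L" "y \<in> carrier L" "x' \<in> carrier L" "y' \<in> carrier L"
    and "x \<sqsubseteq> x'" "y \<sqsubseteq> y'"
  shows "x \<sqinter> y \<sqsubseteq> x' \<sqinter> y'"
proof (rule meet_le)
  show "x \<sqinter> y \<sqsubseteq> x'"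
    by (rule le_trans [OF meet_left]) (use assms in auto)
  show "x \<sqinter> y \<sqsubseteq> y'"
    by (rule le_trans [OF meet_right]) (use assms in auto)
qed (use assms in auto)

text \<open>Both sides are the infimum of \<open>u\<close>, \<open>x\<close> and \<open>y\<close>;
  repeating \<open>u\<close> changes nothing. This is why meeting with a fixed element preserves
  binary meets, as the components of the canonical 1-arrow require.\<close>

lemma meet_distrib_left:
  assumes "u \<in> carrier L" "x \<in> carrier L" "y \<in> carrier L"
  shows "u \<sqinter> (x \<sqinter> y) = (u \<sqinter> x) \<sqinter> (u \<sqinter> y)"
proof (rule meet_eqI [symmetric])
  show "u \<sqinter> (x \<sqinter> y) \<sqsubseteq> u \<sqinter> x" "u \<sqinter> (x \<sqinter> y) \<sqsubseteq> u \<sqinter> y"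
    using assms by (auto intro: meet_mono meet_left meet_right)
next
  fix z assume z: "z \<in> carrier L" "z \<sqsubseteq> u \<sqinter> x" "z \<sqsubseteq> u \<sqinter> y"
  then have "z \<sqsubseteq> u" "z \<sqsubseteq> x" "z \<sqsubseteq> y"
    using assms
    by (auto intro: le_trans [OF _ meet_left, of z u x] le_trans [OF _ meet_right, of z u])
  with z assms show "z \<sqsubseteq> u \<sqinter> (x \<sqinter> y)"
    by (intro meet_le) auto
qed (use assms in auto)

end

section \<open>Principal down-sets and the maps between them\<close>

definition down_set :: "('a, 'x) gorder_scheme \<Rightarrow> 'a \<Rightarrow> ('a, 'x) gorder_scheme"
  where "down_set L u = L\<lparr>carrier := {a \<in> carrier L. a \<sqsubseteq>\<^bsub>L\<^esub> u}\<rparr>"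

lemma carrier_down_set: "carrier (down_set L u) = {a \<in> carrier L. a \<sqsubseteq>\<^bsub>L\<^esub> u}"
  and le_down_set: "le (down_set L u) = le L"
  and eq_down_set: "eq (down_set L u) = eq L"
  by (simp_all add: down_set_def)

lemmas down_set_simps = carrier_down_set le_down_set eq_down_set

lemma partial_order_down_set:
  assumes "partial_order L"
  shows "partial_order (down_set L u)"
proof -
  interpret partial_order L by fact
  show ?thesis
    by unfold_locales (auto simp: down_set_simps eq_is_equal intro: le_trans le_antisym)
qed

context finite_meets
begin

text \<open>The ambient meet lies below \<open>x\<close>, hence below \<open>u\<close>, so it stays
  in the smaller carrier; lower bounds taken inside the down-set are in particular lower bounds in
  \<open>L\<close>.\<close>

lemma greatest_meet_down_set:
  assumes "u \<in> carrier L" "x \<in> carrier (down_set L u)" "y \<in> carrier (down_set L u)"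
  shows "greatest (down_set L u) (x \<sqinter> y) (Lower (down_set L u) {x, y})"
proof -
  have "x \<sqinter> y \<sqsubseteq> u"
    using assms by (auto simp: down_set_simps intro: le_trans [OF meet_left])
  with assms show ?thesis
    by (auto simp: greatest_def Lower_def down_set_simps meet_left meet_right intro: meet_le)
qed

lemma finite_meets_down_set:
  assumes "u \<in> carrier L"
  shows "finite_meets (down_set L u)"
proof -
  interpret D: partial_order "down_set L u"
    by (rule partial_order_down_set) (rule partial_order_axioms)
  show ?thesis
  proof
    fix x y assume "x \<in> carrier (down_set L u)" "y \<in> carrier (down_set L u)"
    then show "\<exists>s. greatest (down_set L u) s (Lower (down_set L u) {x, y})"
      using greatest_meet_down_set assms by blast
  next
    have "greatest (down_set L u) u (carrier (down_set L u))"
      using assms by (auto simp: greatest_def down_set_simps)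
    then show "\<exists>x. greatest (down_set L u) x (carrier (down_set L u))" ..
  qed
qed

lemma top_down_set:
  assumes "u \<in> carrier L"
  shows "\<top>\<^bsub>down_set L u\<^esub> = u"
  by (rule finite_meets.top_eqI [OF finite_meets_down_set])
    (use assms in \<open>auto simp: down_set_simps\<close>)

text \<open>The meet of \<open>down_set L u\<close> is determined by its own carrier, so equality
  with the ambient meet comes from uniqueness: both are greatest lower bounds in the
  down-set.\<close>

lemma meet_down_set:
  assumes "u \<in> carrier L" "x \<in> carrier (down_set L u)" "y \<in> carrier (down_set L u)"
  shows "x \<sqinter>\<^bsub>down_set L u\<^esub> y = x \<sqinter> y"
proof -
  interpret D: finite_meets "down_set L u"
    using assms(1) by (rule finite_meets_down_set)
  show ?thesis
    using D.greatest_unique [OF D.inf_of_two_greatest greatest_meet_down_set] assms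
    by (simp add: meet_def)
qed

end

text \<open>Monotonicity sends an element below \<open>u\<close> to one below \<open>f u\<close>, so
  the codomain can be cut down along with the domain.\<close>

lemma monotone_map_down_set:
  assumes f: "monotone_map L M f" and u: "u \<in> carrier L"
  shows "monotone_map (down_set L u) (down_set M (f u)) f"
proof -
  have po: "partial_order L" "partial_order M" and cl: "f \<in> carrier L \<rightarrow> carrier M"
    and mono: "\<And>x y. \<lbrakk>x \<in> carrier L; y \<in> carrier L; x \<sqsubseteq>\<^bsub>L\<^esub> y\<rbrakk> \<Longrightarrow> f x \<sqsubseteq>\<^bsub>M\<^esub> f y"
    using f by (auto simp: monotone_map_def isotone_def)
  note po_down = po [THEN partial_order_down_set]
  have "isotone (down_set L u) (down_set M (f u)) f"
    using po_down [THEN partial_order.axioms(1)] mono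
    by (auto simp: isotone_def down_set_simps)
  with po_down cl mono u show ?thesis
    by (auto simp: monotone_map_def down_set_simps)
qed

text \<open>The new top elements \<open>u\<close> and \<open>f u\<close> correspond under
  \<open>f\<close>, and binary meets on both sides are the ambient ones, which \<open>f\<close>
  preserves.\<close>

lemma preserves_finite_meets_down_set:
  assumes "finite_meets L" "finite_meets M" "monotone_map L M f"
    and f: "preserves_finite_meets L M f" and u: "u \<in> carrier L"
  shows "preserves_finite_meets (down_set L u) (down_set M (f u)) f"
proof -
  interpret L: finite_meets L by fact
  interpret M: finite_meets M by fact
  have cl: "f \<in> carrier (down_set L u) \<rightarrow> carrier (down_set M (f u))"
    using monotone_map_down_set [OF assms(3) u] by (simp add: monotone_map_def)
  have fu: "f u \<in> carrier M"
    using assms(3) u by (auto simp: monotone_map_def)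
  have "f (x \<sqinter>\<^bsub>down_set L u\<^esub> y) = f x \<sqinter>\<^bsub>down_set M (f u)\<^esub> f y"
    if "x \<in> carrier (down_set L u)" "y \<in> carrier (down_set L u)" for x y
  proof -
    have "f x \<in> carrier (down_set M (f u))" "f y \<in> carrier (down_set M (f u))"
      using cl that by auto
    moreover have "x \<in> carrier L" "y \<in> carrier L"
      using that by (auto simp: down_set_simps)
    ultimately show ?thesis
      using that f u fu by (simp add: L.meet_down_set M.meet_down_set preserves_finite_meets_def)
  qed
  then show ?thesis
    by (simp add: preserves_finite_meets_def L.top_down_set M.top_down_set u fu)
qed


section \<open>The Kleisli category\<close>

lemma is_productD:
  assumes "is_product C A B Q p q"
  shows "Q \<in> Ob C" "p \<in> Hom C Q A" "q \<in> Hom C Q B"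
    and "\<And>Z f g. \<lbrakk>Z \<in> Ob C; f \<in> Hom C Z A; g \<in> Hom C Z B\<rbrakk>
      \<Longrightarrow> \<exists>!h. h \<in> Hom C Z Q \<and> Comp C Z Q A p h = f \<and> Comp C Z Q B q h = g"
  using assms by (auto simp: is_product_def)

context fp_category
begin

lemma Prod_closed: "\<lbrakk>A \<in> Ob C; B \<in> Ob C\<rbrakk> \<Longrightarrow> Prod C A B \<in> Ob C"
  and Pr1_closed: "\<lbrakk>A \<in> Ob C; B \<in> Ob C\<rbrakk> \<Longrightarrow> Pr1 C A B \<in> Hom C (Prod C A B) A"
  and Pr2_closed: "\<lbrakk>A \<in> Ob C; B \<in> Ob C\<rbrakk> \<Longrightarrow> Pr2 C A B \<in> Hom C (Prod C A B) B"
  by (simp_all add: is_productD(1-3) [OF Prod_product])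

text \<open>The universal property supplies the unique existence that makes the definite description
  in \<open>pairing\<close> meaningful.\<close>

lemma pairing:
  assumes "Z \<in> Ob C" "A \<in> Ob C" "B \<in> Ob C" "f \<in> Hom C Z A" "g \<in> Hom C Z B"
  shows pairing_closed: "pairing C Z A B f g \<in> Hom C Z (Prod C A B)"
    and Pr1_pairing: "Comp C Z (Prod C A B) A (Pr1 C A B) (pairing C Z A B f g) = f"
    and Pr2_pairing: "Comp C Z (Prod C A B) B (Pr2 C A B) (pairing C Z A B f g) = g"
  using theI' [OF is_productD(4) [OF Prod_product [OF assms(2,3)] assms(1,4,5)]]
  by (simp_all add: pairing_def)

text \<open>The projections are jointly monic: \<open>h\<close> and \<open>k\<close> both mediate
  the cone obtained from \<open>k\<close>, and mediating arrows are unique.\<close>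

lemma Prod_arrow_eqI:
  assumes "Z \<in> Ob C" "A \<in> Ob C" "B \<in> Ob C"
    and "h \<in> Hom C Z (Prod C A B)" "k \<in> Hom C Z (Prod C A B)"
    and "Comp C Z (Prod C A B) A (Pr1 C A B) h = Comp C Z (Prod C A B) A (Pr1 C A B) k"
    and "Comp C Z (Prod C A B) B (Pr2 C A B) h = Comp C Z (Prod C A B) B (Pr2 C A B) k"
  shows "h = k"
proof -
  have "Comp C Z (Prod C A B) A (Pr1 C A B) k \<in> Hom C Z A"
    and "Comp C Z (Prod C A B) B (Pr2 C A B) k \<in> Hom C Z B"
    using assms by (auto intro: Comp_closed Prod_closed Pr1_closed Pr2_closed)
  from is_productD(4) [OF Prod_product [OF assms(2,3)] assms(1) this] assms(4-7)
  show ?thesis by blast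
qed

end

section \<open>Arrows over \<open>X\<close> and Kleisli composition\<close>

locale kleisli = fp_category C for C :: "('o, 'm) fp_category" +
  fixes X :: 'o
  assumes X_Ob: "X \<in> Ob C"
begin

abbreviation "XP \<equiv> Prod C X"
abbreviation "lift \<equiv> kleisli_lift C X"
abbreviation "F_map \<equiv> hom_map (kleisli_functor C X)"

lemma XP_closed: "A \<in> Ob C \<Longrightarrow> XP A \<in> Ob C"
  and X_Pr1_closed: "A \<in> Ob C \<Longrightarrow> Pr1 C X A \<in> Hom C (XP A) X"
  and X_Pr2_closed: "A \<in> Ob C \<Longrightarrow> Pr2 C X A \<in> Hom C (XP A) A"
  by (simp_all add: X_Ob Prod_closed Pr1_closed Pr2_closed)

lemma lift:
  assumes "A \<in> Ob C" "B \<in> Ob C" "g \<in> Hom C (XP A) B"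
  shows lift_closed: "lift A B g \<in> Hom C (XP A) (XP B)"
    and Pr1_lift: "Comp C (XP A) (XP B) X (Pr1 C X B) (lift A B g) = Pr1 C X A"
    and Pr2_lift: "Comp C (XP A) (XP B) B (Pr2 C X B) (lift A B g) = g"
  using assms pairing [of "XP A" X B "Pr1 C X A" g]
  by (simp_all add: kleisli_lift_def X_Ob XP_closed X_Pr1_closed)

lemma lift_Pr2:
  assumes "A \<in> Ob C"
  shows "lift A A (Pr2 C X A) = Id C (XP A)"
  by (rule Prod_arrow_eqI [of "XP A" X A])
    (simp_all add: assms X_Ob XP_closed X_Pr1_closed X_Pr2_closed lift Comp_Id_right Id_closed)

text \<open>Both sides commute with the projections to \<open>X\<close>, and both have
  \<open>h\<close> after \<open>lift A B g\<close> as second component. Together with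
  \<open>lift_Pr2\<close> this makes \<open>lift\<close> functorial, so that the laws of composition
  and of reindexing can be inherited from \<open>C\<close> and \<open>P\<close>.\<close>

lemma lift_Comp:
  assumes "A \<in> Ob C" "B \<in> Ob C" "D \<in> Ob C" "g \<in> Hom C (XP A) B" "h \<in> Hom C (XP B) D"
  shows "lift A D (Comp C (XP A) (XP B) D h (lift A B g)) =
    Comp C (XP A) (XP B) (XP D) (lift B D h) (lift A B g)"
  by (rule Prod_arrow_eqI [of "XP A" X D])
    (simp_all add: assms X_Ob XP_closed X_Pr1_closed X_Pr2_closed lift Comp_closed
      Comp_assoc [of "XP A" "XP B" "XP D"])

lemma F_map_eq: "F_map A B f = Comp C (XP A) A B f (Pr2 C X A)"
  by (simp add: kleisli_functor_def)

lemma F_map_closed: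
  assumes "A \<in> Ob C" "B \<in> Ob C" "f \<in> Hom C A B"
  shows "F_map A B f \<in> Hom C (XP A) B"
  using assms by (auto simp: F_map_eq intro: Comp_closed XP_closed X_Pr2_closed)

text \<open>Since \<open>Pr2\<close> after \<open>lift Z A h\<close> is \<open>h\<close>, Kleisli
  composition with the image of \<open>f\<close> is plain postcomposition with \<open>f\<close> in
  \<open>C\<close>.\<close>

lemma F_map_lift:
  assumes "Z \<in> Ob C" "A \<in> Ob C" "B \<in> Ob C" "f \<in> Hom C A B" "h \<in> Hom C (XP Z) A"
  shows "Comp C (XP Z) (XP A) B (F_map A B f) (lift Z A h) = Comp C (XP Z) A B f h"
  using assms
  by (simp add: F_map_eq XP_closed X_Pr2_closed lift Comp_assoc [symmetric])

lemma kleisli_category_simps: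
  "Ob (kleisli_category C X) = Ob C"
  "Hom (kleisli_category C X) A B = Hom C (XP A) B"
  "Id (kleisli_category C X) A = Pr2 C X A"
  "Comp (kleisli_category C X) A B D h g = Comp C (XP A) (XP B) D h (lift A B g)"
  "One (kleisli_category C X) = One C"
  "Prod (kleisli_category C X) = Prod C"
  "Pr1 (kleisli_category C X) A B = F_map (Prod C A B) A (Pr1 C A B)"
  "Pr2 (kleisli_category C X) A B = F_map (Prod C A B) B (Pr2 C A B)"
  by (simp_all add: kleisli_category_def)

lemma ob_map_kleisli_functor: "ob_map (kleisli_functor C X) A = A"
  by (simp add: kleisli_functor_def)

text \<open>The left unit law is \<open>Pr2_lift\<close>, the right one follows from
  \<open>lift_Pr2\<close>, and associativity reduces to that of \<open>C\<close> by
  \<open>lift_Comp\<close>.\<close>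

lemma category_kleisli: "category (kleisli_category C X)"
proof (unfold_locales; unfold kleisli_category_simps)
  fix A B D E f g h
  assume "A \<in> Ob C" "B \<in> Ob C" "D \<in> Ob C" "E \<in> Ob C"
    and "f \<in> Hom C (XP A) B" "g \<in> Hom C (XP B) D" "h \<in> Hom C (XP D) E"
  then show "Comp C (XP A) (XP D) E h (lift A D (Comp C (XP A) (XP B) D g (lift A B f))) =
      Comp C (XP A) (XP B) E (Comp C (XP B) (XP D) E h (lift B D g)) (lift A B f)"
    by (simp add: lift_Comp Comp_assoc XP_closed lift_closed)
qed (auto simp: XP_closed X_Pr2_closed lift lift_Pr2 Comp_Id_right intro: Comp_closed)

lemma is_terminal_kleisli:
  assumes "is_terminal C T"
  shows "is_terminal (kleisli_category C X) T"
  using assms by (simp add: is_terminal_def kleisli_category_simps XP_closed)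

text \<open>By \<open>F_map_lift\<close>, a cone from \<open>Z\<close> in \<open>C\<^sub>X\<close> is a cone from \<open>X \<times> Z\<close> in \<open>C\<close>.\<close>

lemma is_product_kleisli:
  assumes "A \<in> Ob C" "B \<in> Ob C" and prod: "is_product C A B Q p q"
  shows "is_product (kleisli_category C X) A B Q (F_map Q A p) (F_map Q B q)"
proof -
  note prodD = is_productD [OF prod]
  have "\<exists>!h. h \<in> Hom C (XP Z) Q \<and>
      Comp C (XP Z) (XP Q) A (F_map Q A p) (lift Z Q h) = f \<and>
      Comp C (XP Z) (XP Q) B (F_map Q B q) (lift Z Q h) = g"
    if "Z \<in> Ob C" "f \<in> Hom C (XP Z) A" "g \<in> Hom C (XP Z) B" for Z f g
    \<comment> \<open>This is the universal property of \<open>Q\<close> in \<open>C\<close> at the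
      object \<open>XP Z\<close>. The rule \<open>conj_cong\<close> makes the membership of
      \<open>h\<close> available when \<open>F_map_lift\<close> rewrites the two equations.\<close>
    using prodD(4) [of "XP Z" f g] that prodD(1-3) assms(1,2)
    by (simp add: XP_closed F_map_lift cong: conj_cong)
  then show ?thesis
    using assms(1,2) prodD(1-3) by (simp add: is_product_def kleisli_category_simps F_map_closed)
qed

lemma fp_category_kleisli: "fp_category (kleisli_category C X)"
proof -
  interpret K: category "kleisli_category C X" by (rule category_kleisli)
  show ?thesis
  proof
    show "is_terminal (kleisli_category C X) (One (kleisli_category C X))"
      using is_terminal_kleisli [OF One_terminal] by (simp add: kleisli_category_simps)
  next
    fix A B assume "A \<in> Ob (kleisli_category C X)" "B \<in> Ob (kleisli_category C X)"
    then show "is_product (kleisli_category C X) A B (Prod (kleisli_category C X) A B)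
        (Pr1 (kleisli_category C X) A B) (Pr2 (kleisli_category C X) A B)"
      by (simp add: kleisli_category_simps is_product_kleisli Prod_product)
  qed
qed

lemma fp_functor_kleisli: "fp_functor C (kleisli_category C X) (kleisli_functor C X)"
proof -
  interpret K: fp_category "kleisli_category C X" by (rule fp_category_kleisli)
  show ?thesis
  proof (unfold_locales; unfold ob_map_kleisli_functor)
    fix A B E f g
    assume "A \<in> Ob C" "B \<in> Ob C" "E \<in> Ob C" "f \<in> Hom C A B" "g \<in> Hom C B E"
    then show "F_map A E (Comp C A B E g f) =
        Comp (kleisli_category C X) A B E (F_map B E g) (F_map A B f)"
      \<comment> \<open>\<open>F_map_lift\<close> turns the Kleisli composite into \<open>g\<close>
        after \<open>F_map A B f\<close>; what remains is associativity in \<open>C\<close>.\<close>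
      by (simp add: kleisli_category_simps F_map_lift F_map_closed)
        (simp add: F_map_eq Comp_assoc XP_closed X_Pr2_closed)
  qed (simp_all add: kleisli_category_simps F_map_closed is_terminal_kleisli is_product_kleisli
      F_map_eq [of _ _ "Id C _"] Comp_Id_left XP_closed X_Pr2_closed)
qed

end


section \<open>The Kleisli doctrine\<close>

locale primary_kleisli = primary_doctrine P for P :: "('o, 'm, 'a) doctrine" +
  fixes X :: 'o and \<phi> :: 'a
  assumes X_Ob: "X \<in> Ob (base P)"
    and phi_closed: "\<phi> \<in> carrier (fib P X)"
begin

sublocale kleisli "base P" X
  by unfold_locales (rule X_Ob)

abbreviation "K \<equiv> kleisli_doctrine P X \<phi>"

definition bound :: "'o \<Rightarrow> 'a"
  where "bound A = reindex P (XP A) X (Pr1 (base P) X A) \<phi>"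

text \<open>The carrier update in \<open>kleisli_doctrine\<close> is exactly
  \<open>down_set\<close>, so the second equation opens the fibres to the order-theoretic results on
  down-sets.\<close>

lemma kleisli_doctrine_simps:
  "base K = kleisli_category (base P) X"
  "fib K A = down_set (fib P (XP A)) (bound A)"
  "reindex K A B g = reindex P (XP A) (XP B) (lift A B g)"
  by (simp_all add: kleisli_doctrine_def Let_def down_set_def bound_def)

lemma reindex_closed:
  assumes "A \<in> Ob (base P)" "B \<in> Ob (base P)" "f \<in> Hom (base P) A B" "\<beta> \<in> carrier (fib P B)"
  shows "reindex P A B f \<beta> \<in> carrier (fib P A)"
  using reindex_monotone [OF assms(1-3)] assms(4) by (auto simp: monotone_map_def)

lemma reindex_meet:
  assumes "A \<in> Ob (base P)" "B \<in> Ob (base P)" "f \<in> Hom (base P) A B"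
    and "\<alpha> \<in> carrier (fib P B)" "\<beta> \<in> carrier (fib P B)"
  shows "reindex P A B f (\<alpha> \<sqinter>\<^bsub>fib P B\<^esub> \<beta>) =
    reindex P A B f \<alpha> \<sqinter>\<^bsub>fib P A\<^esub> reindex P A B f \<beta>"
  using reindex_meets [OF assms(1-3)] assms(4,5) by (simp add: preserves_finite_meets_def)

lemma bound_closed: "A \<in> Ob (base P) \<Longrightarrow> bound A \<in> carrier (fib P (XP A))"
  by (simp add: bound_def reindex_closed X_Ob phi_closed XP_closed X_Pr1_closed)

text \<open>Functoriality of \<open>P\<close> applied to \<open>Pr1_lift\<close>. It identifies the
  down-set generated by the image of \<open>bound B\<close> with the fibre of \<open>K\<close> over
  \<open>A\<close>.\<close>

lemma reindex_lift_bound: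
  assumes "A \<in> Ob (base P)" "B \<in> Ob (base P)" "g \<in> Hom (base P) (XP A) B"
  shows "reindex P (XP A) (XP B) (lift A B g) (bound B) = bound A"
  using assms
  by (simp add: bound_def reindex_Comp [symmetric] X_Ob phi_closed XP_closed X_Pr1_closed lift)

lemma doctrine_kleisli: "doctrine K"
proof (intro doctrine.intro doctrine_axioms.intro;
    unfold kleisli_doctrine_simps kleisli_category_simps)
  show "fp_category (kleisli_category (base P) X)"
    by (rule fp_category_kleisli)
next
  fix A B f
  assume AB: "A \<in> Ob (base P)" "B \<in> Ob (base P)" "f \<in> Hom (base P) (XP A) B"
  show "monotone_map (down_set (fib P (XP B)) (bound B)) (down_set (fib P (XP A)) (bound A))
      (reindex P (XP A) (XP B) (lift A B f))"
    \<comment> \<open>The codomain first appears as the down-set of the reindexed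
      \<open>bound B\<close>; \<open>reindex_lift_bound\<close> rewrites this element to
      \<open>bound A\<close>.\<close>
    using monotone_map_down_set [OF reindex_monotone bound_closed, of "XP A" B "lift A B f"] AB
    by (simp add: XP_closed lift reindex_lift_bound)
qed (simp_all add: partial_order_down_set fib_poset XP_closed lift_Pr2 reindex_Id
    carrier_down_set lift_Comp reindex_Comp lift_closed)

lemma primary_doctrine_kleisli: "primary_doctrine K"
proof (intro primary_doctrine.intro primary_doctrine_axioms.intro doctrine_kleisli;
    unfold kleisli_doctrine_simps kleisli_category_simps)
  fix A assume "A \<in> Ob (base P)"
  then show "finite_meets (down_set (fib P (XP A)) (bound A))"
    by (simp add: finite_meets.finite_meets_down_set fib_meets XP_closed bound_closed)
next
  fix A B f
  assume AB: "A \<in> Ob (base P)" "B \<in> Ob (base P)" "f \<in> Hom (base P) (XP A) B"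
  show "preserves_finite_meets (down_set (fib P (XP B)) (bound B))
      (down_set (fib P (XP A)) (bound A)) (reindex P (XP A) (XP B) (lift A B f))"
    using preserves_finite_meets_down_set
      [OF _ _ _ _ bound_closed [OF AB(2)],
        of "fib P (XP A)" "reindex P (XP A) (XP B) (lift A B f)"] AB
    by (simp add: XP_closed lift_closed reindex_lift_bound fib_meets reindex_monotone
        reindex_meets)
qed

section \<open>The canonical 1-arrow\<close>

lemma kleisli_component_eq:
  "kleisli_component P X \<phi> A \<alpha> =
    bound A \<sqinter>\<^bsub>fib P (XP A)\<^esub> reindex P (XP A) A (Pr2 (base P) X A) \<alpha>"
  by (simp add: kleisli_component_def Let_def bound_def)

lemma kleisli_component_closed:
  assumes "A \<in> Ob (base P)" "\<alpha> \<in> carrier (fib P A)"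
  shows "kleisli_component P X \<phi> A \<alpha> \<in> carrier (fib K A)"
proof -
  interpret fib: finite_meets "fib P (XP A)" by (simp add: fib_meets XP_closed assms)
  show ?thesis
    using assms
    by (simp add: kleisli_component_eq kleisli_doctrine_simps carrier_down_set bound_closed
        reindex_closed XP_closed X_Pr2_closed fib.meet_left)
qed

lemma kleisli_component_monotone:
  assumes A: "A \<in> Ob (base P)"
  shows "monotone_map (fib P A) (fib K A) (kleisli_component P X \<phi> A)"
proof -
  interpret fib: finite_meets "fib P (XP A)" by (simp add: fib_meets XP_closed A)
  interpret K: doctrine K by (rule doctrine_kleisli)
  have po: "partial_order (fib P A)" "partial_order (fib K A)"
    using A K.fib_poset by (simp_all add: fib_poset kleisli_doctrine_simps kleisli_category_simps)
  have "isotone (fib P A) (fib P (XP A)) (reindex P (XP A) A (Pr2 (base P) X A))"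
    using reindex_monotone [OF XP_closed A X_Pr2_closed] A by (simp add: monotone_map_def)
  then have "isotone (fib P A) (fib K A) (kleisli_component P X \<phi> A)"
    using A po [THEN partial_order.axioms(1)]
    by (auto simp: isotone_def kleisli_component_eq kleisli_doctrine_simps(2) le_down_set
        bound_closed reindex_closed XP_closed X_Pr2_closed intro!: fib.meet_mono)
  with po show ?thesis
    using A by (simp add: monotone_map_def kleisli_component_closed)
qed

text \<open>Reindexing distributes over the meet defining the component. The first factor is handled
  by \<open>reindex_lift_bound\<close>, the second by the equality of \<open>f\<close> after
  \<open>Pr2\<close> with \<open>Pr2\<close> after the lift of \<open>F_map A B f\<close>.\<close>

lemma kleisli_component_natural:
  assumes AB: "A \<in> Ob (base P)" "B \<in> Ob (base P)" "f \<in> Hom (base P) A B"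
    and \<beta>: "\<beta> \<in> carrier (fib P B)"
  shows "kleisli_component P X \<phi> A (reindex P A B f \<beta>) =
    reindex K A B (F_map A B f) (kleisli_component P X \<phi> B \<beta>)"
proof -
  have "reindex P (XP A) A (Pr2 (base P) X A) (reindex P A B f \<beta>) =
      reindex P (XP A) B (F_map A B f) \<beta>"
    using assms by (simp add: F_map_eq reindex_Comp XP_closed X_Pr2_closed)
  also have "\<dots> = reindex P (XP A) (XP B) (lift A B (F_map A B f))
      (reindex P (XP B) B (Pr2 (base P) X B) \<beta>)"
    using assms by (simp add: reindex_Comp [symmetric] lift XP_closed X_Pr2_closed F_map_closed)
  finally show ?thesis
    using assms
    by (simp add: kleisli_component_eq kleisli_doctrine_simps(3) reindex_meet reindex_lift_bound
        reindex_closed bound_closed lift_closed XP_closed X_Pr2_closed F_map_closed)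
qed

text \<open>Reindexing along \<open>Pr2\<close> preserves finite meets, and meeting with
  \<open>bound A\<close> preserves binary ones. The top element is sent to \<open>bound A\<close>,
  which is the top of the fibre of \<open>K\<close>.\<close>

lemma kleisli_component_meets:
  assumes A: "A \<in> Ob (base P)"
  shows "preserves_finite_meets (fib P A) (fib K A) (kleisli_component P X \<phi> A)"
proof -
  interpret fib: finite_meets "fib P (XP A)" by (simp add: fib_meets XP_closed A)
  let ?t = "kleisli_component P X \<phi> A"
  have pr2: "preserves_finite_meets (fib P A) (fib P (XP A))
      (reindex P (XP A) A (Pr2 (base P) X A))"
    using A by (simp add: reindex_meets XP_closed X_Pr2_closed)
  have "?t (x \<sqinter>\<^bsub>fib P A\<^esub> y) = ?t x \<sqinter>\<^bsub>fib K A\<^esub> ?t y"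
    if xy: "x \<in> carrier (fib P A)" "y \<in> carrier (fib P A)" for x y
  proof -
    have "?t x \<sqinter>\<^bsub>fib K A\<^esub> ?t y = ?t x \<sqinter>\<^bsub>fib P (XP A)\<^esub> ?t y"
      using kleisli_component_closed [OF A xy(1)] kleisli_component_closed [OF A xy(2)] A
      by (simp add: kleisli_doctrine_simps fib.meet_down_set bound_closed)
    with A xy pr2 show ?thesis
      by (simp add: kleisli_component_eq preserves_finite_meets_def
          fib.meet_distrib_left [of "bound A"]
          bound_closed reindex_closed XP_closed X_Pr2_closed)
  qed
  moreover have "?t \<top>\<^bsub>fib P A\<^esub> = \<top>\<^bsub>fib K A\<^esub>"
    using pr2 A
    by (simp add: preserves_finite_meets_def kleisli_component_eq kleisli_doctrine_simps(2)
        fib.top_down_set fib.meet_top bound_closed)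
  ultimately show ?thesis
    by (simp add: preserves_finite_meets_def)
qed

lemma primary_hom_kleisli:
  "primary_hom P K (kleisli_functor (base P) X) (kleisli_component P X \<phi>)"
proof -
  interpret K: primary_doctrine K by (rule primary_doctrine_kleisli)
  interpret F: fp_functor "base P" "base K" "kleisli_functor (base P) X"
    unfolding kleisli_doctrine_simps by (rule fp_functor_kleisli)
  show ?thesis
    by (unfold_locales; unfold ob_map_kleisli_functor)
      (simp_all add: kleisli_component_monotone kleisli_component_natural kleisli_component_meets)
qed

end

theorem proposition5p3:
  fixes P :: "('o, 'm, 'a) doctrine" and X :: 'o and \<phi> :: 'a
  assumes "primary_doctrine P"
    and "X \<in> Ob (base P)"
    and "\<phi> \<in> carrier (fib P X)"
  shows "primary_doctrine (kleisli_doctrine P X \<phi>) \<and>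
    primary_hom P (kleisli_doctrine P X \<phi>)
      (kleisli_functor (base P) X) (kleisli_component P X \<phi>)"
proof -
  interpret primary_doctrine P by fact
  interpret primary_kleisli P X \<phi>
    by unfold_locales (fact assms)+
  show ?thesis
    using primary_doctrine_kleisli primary_hom_kleisli ..
qed

end
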